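(* A Banach space $X$ contains an isomorphic copy of $c_0$ if and only if $X$ admits an equivalent norm for which it is $(1,<1)$-$\mathrm{SQ}_{<\aleph_0}$.
   Context: For $s\in(0,1]$, a Banach space $Z$ is $(1,s)$-$\mathrm{SQ}_{<\aleph_0}$ if for every finite set $A\subset S_Z$ there exists $y\in S_Z$ with $\|x\pm sy\|\le 1$ for all $x\in A$. $Z$ is $(1,<1)$-$\mathrm{SQ}_{<\aleph_0}$ if it is $(1,s)$-$\mathrm{SQ}_{<\aleph_0}$ for every $s\in(0,1)$. *)

theory Defs
  imports "HOL-Analysis.Analysis"
begin

definition c0 :: "(nat \<Rightarrow> real) set" where
  "c0 = {x. x \<longlonglongrightarrow> 0}"

definition c0_norm :: "(nat \<Rightarrow> real) \<Rightarrow> real" where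
  "c0_norm x = (SUP n. \<bar>x n\<bar>)"

definition contains_c0 :: "'a::real_normed_vector itself \<Rightarrow> bool" where
  "contains_c0 _ \<longleftrightarrow> (\<exists>T :: (nat \<Rightarrow> real) \<Rightarrow> 'a.
      (\<forall>x\<in>c0. \<forall>y\<in>c0. T (\<lambda>n. x n + y n) = T x + T y) \<and>
      (\<forall>c. \<forall>x\<in>c0. T (\<lambda>n. c * x n) = c *\<^sub>R T x) \<and>
      (\<exists>a b. 0 < a \<and> 0 < b \<and>
         (\<forall>x\<in>c0. a * c0_norm x \<le> norm (T x) \<and> norm (T x) \<le> b * c0_norm x)))"

definition equivalent_norm :: "('a::real_normed_vector \<Rightarrow> real) \<Rightarrow> bool" where
  "equivalent_norm N \<longleftrightarrow>
     (\<forall>x y. N (x + y) \<le> N x + N y) \<and>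
     (\<forall>c x. N (c *\<^sub>R x) = \<bar>c\<bar> * N x) \<and>
     (\<forall>x. N x = 0 \<longleftrightarrow> x = 0) \<and>
     (\<exists>a b. 0 < a \<and> 0 < b \<and> (\<forall>x. a * norm x \<le> N x \<and> N x \<le> b * norm x))"

definition SQ_fin :: "('a::real_normed_vector \<Rightarrow> real) \<Rightarrow> real \<Rightarrow> bool" where
  "SQ_fin N s \<longleftrightarrow>
     (\<forall>A. finite A \<and> A \<subseteq> {x. N x = 1} \<longrightarrow>
        (\<exists>y. N y = 1 \<and> (\<forall>x\<in>A. N (x + s *\<^sub>R y) \<le> 1 \<and> N (x - s *\<^sub>R y) \<le> 1)))"

definition SQ_lt1_fin :: "('a::real_normed_vector \<Rightarrow> real) \<Rightarrow> bool" where
  "SQ_lt1_fin N \<longleftrightarrow> (\<forall>s. 0 < s \<and> s < 1 \<longrightarrow> SQ_fin N s)"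

end

theory Submission
  imports Defs
begin

text \<open>
  Suppose a copy of c0 with unit vectors \<open>e\<^sub>n\<close> sits in X. Extend its coordinate functionals to a bounded
  sequence \<open>h\<^sub>n\<close> in the dual of X by Hahn--Banach, and let \<open>L\<close> be a weak* cluster point of it. Since \<open>L\<close>
  vanishes on c0, the functionals \<open>g\<^sub>n = h\<^sub>n - L\<close> still extend the coordinates, and they are now
  simultaneously small on any finite set for suitable \<open>n\<close>. The norm
  \<open>max (dist (x, c0)) (sup\<^sub>n \<bar>g\<^sub>n x\<bar>)\<close> is equivalent to the original one, and \<open>y = e\<^sub>n\<close> for such
  an \<open>n\<close> is the required direction.

  Conversely, applying the condition with \<open>s = 2/3\<close> inductively to the sign sums of the vectors found so
  far gives normalised \<open>y\<^sub>n\<close> all of whose sign sums have norm at most 3/2. By convexity \<open>\<Sum>c\<^sub>i y\<^sub>i\<close> has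
  norm at most \<open>3/2 max \<bar>c\<^sub>i\<bar>\<close>. Since \<open>2 c\<^sub>j y\<^sub>j\<close> is the sum of \<open>\<Sum>c\<^sub>i y\<^sub>i\<close> and the same vector with all
  signs but the \<open>j\<close>-th reversed, that norm is at least \<open>(2 - 3/2) max \<bar>c\<^sub>i\<bar>\<close>.
\<close>

section \<open>Sublinear functionals and the Hahn-Banach theorem\<close>

definition sublinear :: "('a::real_vector \<Rightarrow> real) \<Rightarrow> bool" where
  "sublinear q \<longleftrightarrow> (\<forall>x y. q (x + y) \<le> q x + q y) \<and> (\<forall>c x. 0 \<le> c \<longrightarrow> q (c *\<^sub>R x) = c * q x)"

text \<open>Applying the scaling inequality with \<open>inverse c\<close> at
  \<open>c *\<^sub>R x\<close> gives its converse. At the origin, the factors \<open>1/2\<close> and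
  \<open>2\<close> force \<open>q 0 \<le> 0\<close> and \<open>q 0 \<ge> 0\<close>.\<close>

lemma sublinearI:
  assumes add: "\<And>x y. q (x + y) \<le> q x + q y"
    and scale: "\<And>c x. 0 < c \<Longrightarrow> q (c *\<^sub>R x) \<le> c * q x"
  shows "sublinear q"
proof -
  have "q 0 \<le> (1/2) * q 0" "q 0 \<le> 2 * q 0"
    using scale[of "1/2" 0] scale[of 2 0] by simp_all
  then have q0: "q 0 = 0" by simp
  have "q (c *\<^sub>R x) = c * q x" if "0 < c" for c x
    using scale[of c x] scale[of "inverse c" "c *\<^sub>R x"] that by (simp add: field_simps)
  then show ?thesis
    unfolding sublinear_def using add q0 by (metis less_eq_real_def mult_zero_left scaleR_zero_left)
qed

lemma sublinear_add: "sublinear q \<Longrightarrow> q (x + y) \<le> q x + q y"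
  by (simp add: sublinear_def)

lemma sublinear_scale: "sublinear q \<Longrightarrow> 0 \<le> c \<Longrightarrow> q (c *\<^sub>R x) = c * q x"
  by (simp add: sublinear_def)

lemma sublinear_zero: "sublinear q \<Longrightarrow> q 0 = 0"
  using sublinear_scale[of q 0 0] by simp

lemma sublinear_ge_minus: "sublinear q \<Longrightarrow> - q (- x) \<le> q x"
  using sublinear_add[of q x "- x"] sublinear_zero[of q] by simp

text \<open>The members \<open>f i\<close> need not be sublinear one by one: the index
  \<open>k\<close> may differ from \<open>i\<close> and \<open>j\<close> and depend on the vectors.
  This covers infima over chains, over shifts along a ray, and over points of a subspace.\<close>

lemma sublinear_INF:
  fixes f :: "'i \<Rightarrow> 'a::real_vector \<Rightarrow> real"
  assumes ne: "I \<noteq> {}" and bdd: "\<And>x. bdd_below ((\<lambda>i. f i x) ` I)"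
    and add: "\<And>i j x y. i \<in> I \<Longrightarrow> j \<in> I \<Longrightarrow> \<exists>k\<in>I. f k (x + y) \<le> f i x + f j y"
    and scale: "\<And>i c x. i \<in> I \<Longrightarrow> 0 < c \<Longrightarrow> \<exists>k\<in>I. f k (c *\<^sub>R x) \<le> c * f i x"
  shows "sublinear (\<lambda>x. INF i\<in>I. f i x)"
proof (rule sublinearI)
  fix x y
  let ?q = "\<lambda>x. INF i\<in>I. f i x"
  have 1: "?q (x + y) \<le> f i x + f j y" if "i \<in> I" "j \<in> I" for i j
    using add[OF that, of x y] cINF_lower2[OF bdd] by metis
  have "?q (x + y) - f i x \<le> ?q y" if "i \<in> I" for i
    by (rule cINF_greatest[OF ne]) (use 1[OF that] in \<open>simp add: algebra_simps\<close>)
  then have "?q (x + y) - ?q y \<le> ?q x"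
    by (intro cINF_greatest[OF ne]) (simp add: algebra_simps)
  then show "?q (x + y) \<le> ?q x + ?q y" by simp
next
  fix c :: real and x
  assume c: "0 < c"
  let ?q = "\<lambda>x. INF i\<in>I. f i x"
  have "?q (c *\<^sub>R x) \<le> c * f i x" if "i \<in> I" for i
    using scale[OF that c, of x] cINF_lower2[OF bdd] by metis
  then have "?q (c *\<^sub>R x) / c \<le> ?q x"
    by (intro cINF_greatest[OF ne]) (use c in \<open>simp add: field_simps\<close>)
  then show "?q (c *\<^sub>R x) \<le> c * ?q x" using c by (simp add: field_simps)
qed

text \<open>
  Hahn--Banach is obtained from Zorn's lemma applied to sublinear functionals rather than to partial
  linear ones: a minimal sublinear functional is linear.
\<close>
lemma minimal_sublinear_exists:
  fixes p :: "'a::real_vector \<Rightarrow> real"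
  assumes p: "sublinear p"
  obtains q where "sublinear q" "q \<le> p" "\<And>r. sublinear r \<Longrightarrow> r \<le> q \<Longrightarrow> r = q"
proof -
  define A where "A = {q. sublinear q \<and> q \<le> p}"
  \<comment> \<open>The order is reversed, so that a maximal element in Zorn's lemma is a minimal
    functional.\<close>
  define P where "P = (\<lambda>f g :: 'a \<Rightarrow> real. g \<le> f)"
  \<comment> \<open>A lower bound common to all of \<open>A\<close>; it makes the pointwise infimum
    over a chain finite.\<close>
  have lower: "- p (- x) \<le> q x" if "q \<in> A" for q x
  proof -
    have "q (- x) \<le> p (- x)" "sublinear q" using that by (auto simp: A_def le_fun_def)
    then show ?thesis using sublinear_ge_minus[of q x] by simp
  qed
  have "\<exists>m\<in>A. \<forall>a\<in>A. P m a \<longrightarrow> a = m"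
  proof (rule predicate_Zorn)
    show "partial_order_on A (relation_of P A)"
      by (rule partial_order_on_relation_ofI) (auto simp: P_def)
  next
    fix C assume "C \<in> Chains (relation_of P A)"
    then have C: "C \<subseteq> A" "\<And>f g. f \<in> C \<Longrightarrow> g \<in> C \<Longrightarrow> f \<le> g \<or> g \<le> f"
      by (auto simp: Chains_def relation_of_def P_def)
    show "\<exists>u\<in>A. \<forall>a\<in>C. P a u"
    proof (cases "C = {}")
      case True
      then show ?thesis using p by (auto simp: A_def)
    next
      case False
      define u where "u = (\<lambda>x. INF q\<in>C. q x)"
      have bdd: "bdd_below ((\<lambda>q. q x) ` C)" for x
        using lower C(1) by (intro bdd_belowI2[where m = "- p (- x)"]) auto
      have "sublinear u" unfolding u_def
      proof (rule sublinear_INF[OF False bdd])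
        fix i j and x y :: 'a
        assume ij: "i \<in> C" "j \<in> C"
        then have s: "sublinear i" "sublinear j" using C(1) by (auto simp: A_def)
        \<comment> \<open>The smaller of the two functionals serves as \<open>k\<close>.\<close>
        from C(2)[OF ij] show "\<exists>k\<in>C. k (x + y) \<le> i x + j y"
        proof
          assume "i \<le> j"
          then have "i y \<le> j y" by (simp add: le_fun_def)
          then show ?thesis using sublinear_add[OF s(1), of x y] ij(1) by (intro bexI[of _ i]) auto
        next
          assume "j \<le> i"
          then have "j x \<le> i x" by (simp add: le_fun_def)
          then show ?thesis using sublinear_add[OF s(2), of x y] ij(2) by (intro bexI[of _ j]) auto
        qed
      next
        fix i and c :: real and x :: 'a
        assume "i \<in> C" "0 < c"
        then show "\<exists>k\<in>C. k (c *\<^sub>R x) \<le> c * i x"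
          using C(1) sublinear_scale[of i c x] by (auto simp: A_def intro!: bexI[of _ i])
      qed
      moreover have le: "u \<le> q" if "q \<in> C" for q
        unfolding u_def le_fun_def using bdd that by (auto intro: cINF_lower)
      moreover have "u \<le> p"
        using False C(1) le by (auto simp: A_def intro: order_trans)
      ultimately show ?thesis by (auto simp: A_def P_def)
    qed
  qed
  then obtain q where q: "q \<in> A" "\<And>r. r \<in> A \<Longrightarrow> r \<le> q \<Longrightarrow> r = q" by (auto simp: P_def)
  show thesis
  proof (rule that)
    show "sublinear q" "q \<le> p" using q(1) by (auto simp: A_def)
    fix r assume "sublinear r" "r \<le> q"
    then show "r = q" using q \<open>q \<le> p\<close> by (auto simp: A_def)
  qed
qed

lemma minimal_sublinear_linear:
  fixes q :: "'a::real_vector \<Rightarrow> real"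
  assumes q: "sublinear q" and min: "\<And>r. sublinear r \<Longrightarrow> r \<le> q \<Longrightarrow> r = q"
  shows "linear q"
proof -
  have add: "q (y + x) = q y + q x" for x y
  proof -
    \<comment> \<open>The sublinear functional \<open>r\<close> lies below \<open>q\<close>, so it equals \<open>q\<close>; comparing at \<open>t = 1\<close> gives superadditivity.\<close>
    define f where "f = (\<lambda>t y. q (y + t *\<^sub>R x) - t * q x)"
    define r where "r = (\<lambda>y. INF t\<in>{0..}. f t y)"
    have bdd: "bdd_below ((\<lambda>t. f t y) ` {0..})" for y
    proof (rule bdd_belowI2)
      fix t :: real assume "t \<in> {0..}"
      then show "- q (- y) \<le> f t y"
        using sublinear_add[OF q, of "y + t *\<^sub>R x" "- y"] sublinear_scale[OF q, of t x]
        by (simp add: f_def)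
    qed
    have "sublinear r" unfolding r_def
    proof (rule sublinear_INF[OF _ bdd])
      fix s t :: real and y z assume "s \<in> {0..}" "t \<in> {0..}"
      then show "\<exists>k\<in>{0..}. f k (y + z) \<le> f s y + f t z"
        using sublinear_add[OF q, of "y + s *\<^sub>R x" "z + t *\<^sub>R x"]
        by (intro bexI[of _ "s + t"]) (auto simp: f_def algebra_simps)
    next
      fix t c :: real and y assume "t \<in> {0..}" "0 < c"
      then show "\<exists>k\<in>{0..}. f k (c *\<^sub>R y) \<le> c * f t y"
        using sublinear_scale[OF q, of c "y + t *\<^sub>R x"]
        by (intro bexI[of _ "c * t"]) (auto simp: f_def algebra_simps)
    qed auto
    moreover have le: "r z \<le> f t z" if "0 \<le> t" for t z
      unfolding r_def using bdd that by (auto intro: cINF_lower)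
    moreover have "r \<le> q"
      using le[of 0] by (simp add: le_fun_def f_def)
    ultimately have "r = q" using min by blast
    then have "q y \<le> q (y + x) - q x" using le[of 1 y] by (simp add: f_def)
    then show ?thesis using sublinear_add[OF q, of y x] by simp
  qed
  have neg: "q (- x) = - q x" for x
    using add[of x "- x"] sublinear_zero[OF q] by simp
  show ?thesis
  proof (rule linearI)
    show "q (c *\<^sub>R x) = c *\<^sub>R q x" for c x
      using sublinear_scale[OF q, of c x] sublinear_scale[OF q, of "- c" x] neg[of "c *\<^sub>R x"]
      by (cases "0 \<le> c") auto
  qed (rule add)
qed

text \<open>Here \<open>p\<close> is the infimal convolution of the norm with \<open>\<phi>\<close>
  on \<open>Y\<close>. It encodes both the extension and the norm bound in one sublinear functional.
  With \<open>\<phi> = 0\<close> it is the distance to \<open>Y\<close>, which the renorming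
  uses.\<close>

lemma sublinear_inf_convolution:
  fixes \<phi> :: "'a::real_normed_vector \<Rightarrow> real"
  assumes Y: "subspace Y"
    and add: "\<And>y z. y \<in> Y \<Longrightarrow> z \<in> Y \<Longrightarrow> \<phi> (y + z) = \<phi> y + \<phi> z"
    and scale: "\<And>c y. y \<in> Y \<Longrightarrow> \<phi> (c *\<^sub>R y) = c * \<phi> y"
    and bound: "\<And>y. y \<in> Y \<Longrightarrow> \<bar>\<phi> y\<bar> \<le> norm y"
  defines "p \<equiv> \<lambda>x. INF y\<in>Y. norm (x - y) + \<phi> y"
  shows "sublinear p" "\<And>x y. y \<in> Y \<Longrightarrow> p x \<le> norm (x - y) + \<phi> y"
proof -
  have bdd: "bdd_below ((\<lambda>y. norm (x - y) + \<phi> y) ` Y)" for x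
  proof (rule bdd_belowI2)
    fix y assume "y \<in> Y"
    then show "- norm x \<le> norm (x - y) + \<phi> y"
      using bound[of y] norm_triangle_ineq2[of y x] norm_minus_commute[of x y] by simp
  qed
  show "sublinear p" unfolding p_def
  proof (rule sublinear_INF[OF _ bdd])
    show "Y \<noteq> {}" using subspace_0[OF Y] by auto
  next
    fix i j x y assume "i \<in> Y" "j \<in> Y"
    then show "\<exists>k\<in>Y. norm (x + y - k) + \<phi> k \<le> norm (x - i) + \<phi> i + (norm (y - j) + \<phi> j)"
      using norm_triangle_ineq[of "x - i" "y - j"] subspace_add[OF Y] add
      by (intro bexI[of _ "i + j"]) (auto simp: algebra_simps)
  next
    fix i x and c :: real assume "i \<in> Y" "0 < c"
    moreover have "norm (c *\<^sub>R x - c *\<^sub>R i) = c * norm (x - i)"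
      using \<open>0 < c\<close> by (simp flip: scaleR_diff_right)
    ultimately show "\<exists>k\<in>Y. norm (c *\<^sub>R x - k) + \<phi> k \<le> c * (norm (x - i) + \<phi> i)"
      using subspace_scale[OF Y] scale by (intro bexI[of _ "c *\<^sub>R i"]) (auto simp: algebra_simps)
  qed
  show "p x \<le> norm (x - y) + \<phi> y" if "y \<in> Y" for x y
    unfolding p_def using bdd that by (rule cINF_lower)
qed

text \<open>A linear \<open>f\<close> below \<open>p\<close> does everything: \<open>y = 0\<close>
  gives \<open>f \<le> norm\<close>, and taking the point itself as \<open>y\<close> gives
  \<open>f \<le> \<phi>\<close> on \<open>Y\<close>. Replacing vectors by their negatives turns
  these into the absolute bound and equality on \<open>Y\<close>.\<close>

theorem Hahn_Banach_norm:
  fixes \<phi> :: "'a::real_normed_vector \<Rightarrow> real"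
  assumes Y: "subspace Y"
    and add: "\<And>y z. y \<in> Y \<Longrightarrow> z \<in> Y \<Longrightarrow> \<phi> (y + z) = \<phi> y + \<phi> z"
    and scale: "\<And>c y. y \<in> Y \<Longrightarrow> \<phi> (c *\<^sub>R y) = c * \<phi> y"
    and bound: "\<And>y. y \<in> Y \<Longrightarrow> \<bar>\<phi> y\<bar> \<le> norm y"
  obtains f where "linear f" "\<And>y. y \<in> Y \<Longrightarrow> f y = \<phi> y" "\<And>x. \<bar>f x\<bar> \<le> norm x"
proof -
  define p where "p = (\<lambda>x. INF y\<in>Y. norm (x - y) + \<phi> y)"
  have p: "sublinear p" "\<And>x y. y \<in> Y \<Longrightarrow> p x \<le> norm (x - y) + \<phi> y"
    unfolding p_def using sublinear_inf_convolution[of Y \<phi>] assms by blast+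
  obtain f where f: "sublinear f" "f \<le> p" "\<And>r. sublinear r \<Longrightarrow> r \<le> f \<Longrightarrow> r = f"
    using minimal_sublinear_exists[OF p(1)] by blast
  have lin: "linear f" by (rule minimal_sublinear_linear) (use f in auto)
  have le: "f x \<le> norm (x - y) + \<phi> y" if "y \<in> Y" for x y
    using f(2) p(2)[OF that, of x] by (auto simp: le_fun_def intro: order_trans)
  have "\<phi> 0 = 0" using scale[of 0 0] subspace_0[OF Y] by simp
  then have norm: "f x \<le> norm x" for x using le[OF subspace_0[OF Y], of x] by simp
  show thesis
  proof (rule that[OF lin])
    fix y assume y: "y \<in> Y"
    have "f y \<le> \<phi> y" "f (- y) \<le> \<phi> (- y)"
      using le[OF y, of y] le[of "- y" "- y"] subspace_neg[OF Y y] by auto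
    then show "f y = \<phi> y"
      using scale[OF y, of "- 1"] linear_neg[OF lin, of y] by simp
  next
    show "\<bar>f x\<bar> \<le> norm x" for x
      using norm[of x] norm[of "- x"] linear_neg[OF lin, of x] by simp
  qed
qed

section \<open>Cluster points of pointwise bounded sequences of functionals\<close>

text \<open>By Tychonoff's theorem the product of the intervals \<open>{- B x..B x}\<close> is
  compact, and it contains every \<open>f n\<close>. Basic neighbourhoods in the product topology
  restrict finitely many coordinates, whence the finite set \<open>A\<close>.\<close>

lemma pointwise_cluster_point:
  fixes f :: "nat \<Rightarrow> 'a \<Rightarrow> real"
  assumes "\<And>n x. \<bar>f n x\<bar> \<le> B x"
  obtains L where "\<And>A e m. finite A \<Longrightarrow> 0 < e \<Longrightarrow> \<exists>n\<ge>m. \<forall>x\<in>A. \<bar>f n x - L x\<bar> < e"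
proof -
  define K where "K = PiE UNIV (\<lambda>x. {- B x..B x})"
  have "compact K"
    using compactin_PiE[of "\<lambda>_. euclidean" UNIV "\<lambda>x. {- B x..B x}"]
    by (simp add: K_def euclidean_product_topology)
  moreover have "f n \<in> K" for n
    using assms[of n] by (auto simp: K_def abs_le_iff minus_le_iff)
  then have "eventually (\<lambda>g. g \<in> K) (filtermap f sequentially)"
    by (simp add: eventually_filtermap)
  moreover have "filtermap f sequentially \<noteq> bot" by (simp add: filtermap_bot_iff)
  \<comment> \<open>Nontriviality of this infimum of filters says that \<open>L\<close> is a cluster
    point of the sequence.\<close>
  ultimately obtain L where L: "inf (nhds L) (filtermap f sequentially) \<noteq> bot"
    unfolding compact_filter by blast
  show thesis
  proof (rule that)
    fix A :: "'a set" and e :: real and m :: nat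
    assume "finite A" "0 < e"
    then have "open {g. \<forall>x\<in>A. g x \<in> ball (L x) e}"
      using product_topology_basis'[of A "\<lambda>x. ball (L x) e" "\<lambda>x. x"] by simp
    then have 1: "eventually (\<lambda>g. \<forall>x\<in>A. g x \<in> ball (L x) e) (nhds L)"
      using \<open>0 < e\<close> by (auto simp: eventually_nhds)
    show "\<exists>n\<ge>m. \<forall>x\<in>A. \<bar>f n x - L x\<bar> < e"
    proof (rule ccontr)
      assume "\<not> ?thesis"
      then have "eventually (\<lambda>n. \<not> (\<forall>x\<in>A. f n x \<in> ball (L x) e)) sequentially"
        by (auto simp: eventually_sequentially dist_real_def abs_minus_commute)
      then have "eventually (\<lambda>g. \<not> (\<forall>x\<in>A. g x \<in> ball (L x) e)) (filtermap f sequentially)"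
        by (simp add: eventually_filtermap)
      with 1 have "eventually (\<lambda>_. False) (inf (nhds L) (filtermap f sequentially))"
        unfolding eventually_inf by blast
      with L show False by (simp add: trivial_limit_def)
    qed
  qed
qed

text \<open>One index \<open>n\<close> approximates \<open>L\<close> at all points occurring in a
  linearity identity at once, so the identity passes from \<open>f n\<close> to \<open>L\<close> up
  to an arbitrary error.\<close>

lemma linear_cluster_point:
  fixes f :: "nat \<Rightarrow> 'a::real_vector \<Rightarrow> real"
  assumes lin: "\<And>n. linear (f n)"
    and L: "\<And>A e m. finite A \<Longrightarrow> 0 < e \<Longrightarrow> \<exists>n\<ge>m. \<forall>x\<in>A. \<bar>f n x - L x\<bar> < e"
  shows "linear L"
proof (rule linearI)
  fix x y
  have "\<bar>L (x + y) - (L x + L y)\<bar> \<le> 0 + e" if e: "0 < e" for e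
  proof -
    obtain n where n: "\<forall>z\<in>{x + y, x, y}. \<bar>f n z - L z\<bar> < e / 3"
      using L[of "{x + y, x, y}" "e / 3" 0] e by auto
    then show ?thesis using linear_add[OF lin, of n x y] by (auto simp: abs_if split: if_splits)
  qed
  then have "\<bar>L (x + y) - (L x + L y)\<bar> \<le> 0" by (rule field_le_epsilon)
  then show "L (x + y) = L x + L y" by simp
next
  fix c :: real and x
  have "\<bar>L (c *\<^sub>R x) - c * L x\<bar> \<le> 0 + e" if e: "0 < e" for e
  proof -
    \<comment> \<open>The error at \<open>x\<close> enters with factor \<open>\<bar>c\<bar>\<close>
      and the error at \<open>c *\<^sub>R x\<close> with factor one, so the total is
      \<open>e\<close>.\<close>
    have pos: "0 < e / (1 + \<bar>c\<bar>)" using e by (simp add: add_pos_nonneg)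
    obtain n where n: "\<forall>z\<in>{c *\<^sub>R x, x}. \<bar>f n z - L z\<bar> < e / (1 + \<bar>c\<bar>)"
      using L[OF _ pos, of "{c *\<^sub>R x, x}" 0] by auto
    have "L (c *\<^sub>R x) - c * L x = c * (f n x - L x) - (f n (c *\<^sub>R x) - L (c *\<^sub>R x))"
      using linear_scale[OF lin, of n c x] by (simp add: algebra_simps)
    also have "\<bar>\<dots>\<bar> \<le> \<bar>c\<bar> * \<bar>f n x - L x\<bar> + \<bar>f n (c *\<^sub>R x) - L (c *\<^sub>R x)\<bar>"
      by (metis abs_mult abs_triangle_ineq4)
    also have "\<dots> \<le> \<bar>c\<bar> * (e / (1 + \<bar>c\<bar>)) + e / (1 + \<bar>c\<bar>)"
      using n by (intro add_mono mult_left_mono) auto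
    also have "\<dots> = (1 + \<bar>c\<bar>) * (e / (1 + \<bar>c\<bar>))" by (simp only: distrib_right mult_1)
    also have "\<dots> = e" using pos e by auto
    finally show ?thesis by simp
  qed
  then have "\<bar>L (c *\<^sub>R x) - c * L x\<bar> \<le> 0" by (rule field_le_epsilon)
  then show "L (c *\<^sub>R x) = c *\<^sub>R L x" by simp
qed

section \<open>The space c0 and coordinate functionals on a copy of it\<close>

lemma c0_add: "x \<in> c0 \<Longrightarrow> y \<in> c0 \<Longrightarrow> (\<lambda>n. x n + y n) \<in> c0"
  unfolding c0_def using tendsto_add[of x 0 sequentially y 0] by simp

lemma c0_scale: "x \<in> c0 \<Longrightarrow> (\<lambda>n. c * x n) \<in> c0"
  unfolding c0_def using tendsto_mult_right_zero[of x sequentially c] by simp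

lemma c0_norm_upper:
  assumes "x \<in> c0"
  shows "\<bar>x n\<bar> \<le> c0_norm x"
proof -
  have "Bseq x" using assms convergentI[of x 0] by (auto simp: c0_def intro: convergent_imp_Bseq)
  then obtain K where "\<And>n. \<bar>x n\<bar> \<le> K" by (auto simp: Bseq_def)
  then have "bdd_above (range (\<lambda>n. \<bar>x n\<bar>))" by (rule bdd_aboveI2)
  then show ?thesis unfolding c0_norm_def by (rule cSUP_upper[OF UNIV_I])
qed

lemma c0_norm_least: "(\<And>n. \<bar>x n\<bar> \<le> M) \<Longrightarrow> c0_norm x \<le> M"
  unfolding c0_norm_def by (rule cSUP_least) auto

lemma c0_unit: "(\<lambda>m. of_bool (m = n)) \<in> c0"
  unfolding c0_def mem_Collect_eq
  by (rule tendsto_eventually) (auto simp: eventually_sequentially intro!: exI[of _ "Suc n"])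

lemma subspace_image_c0:
  fixes T :: "(nat \<Rightarrow> real) \<Rightarrow> 'a::real_vector"
  assumes add: "\<And>x y. x \<in> c0 \<Longrightarrow> y \<in> c0 \<Longrightarrow> T (\<lambda>n. x n + y n) = T x + T y"
    and scale: "\<And>c x. x \<in> c0 \<Longrightarrow> T (\<lambda>n. c * x n) = c *\<^sub>R T x"
  shows "subspace (T ` c0)"
proof (rule subspaceI)
  show "0 \<in> T ` c0"
    using scale[of "\<lambda>_. 0" 0] by (force simp: c0_def)
  show "x + y \<in> T ` c0" if "x \<in> T ` c0" "y \<in> T ` c0" for x y
    using that c0_add by (auto simp flip: add)
  show "c *\<^sub>R x \<in> T ` c0" if "x \<in> T ` c0" for c x
    using that c0_scale by (auto simp flip: scale)
qed

text \<open>The lower estimate makes \<open>T\<close> injective, so each coordinate is a functional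
  on the copy, of norm at most \<open>1 / a\<close>. It is multiplied by \<open>a\<close> to be
  dominated by the norm, extended, and divided by \<open>a\<close> again.\<close>

lemma c0_copy_coordinate_functionals:
  fixes T :: "(nat \<Rightarrow> real) \<Rightarrow> 'a::real_normed_vector"
  assumes add: "\<And>x y. x \<in> c0 \<Longrightarrow> y \<in> c0 \<Longrightarrow> T (\<lambda>n. x n + y n) = T x + T y"
    and scale: "\<And>c x. x \<in> c0 \<Longrightarrow> T (\<lambda>n. c * x n) = c *\<^sub>R T x"
    and a: "0 < a" and lower: "\<And>x. x \<in> c0 \<Longrightarrow> a * c0_norm x \<le> norm (T x)"
  obtains h where "\<And>n. linear (h n)" "\<And>n x. x \<in> c0 \<Longrightarrow> h n (T x) = x n"
    "\<And>n x. \<bar>h n x\<bar> \<le> norm x / a"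
proof -
  have inj: "inj_on T c0"
  proof (rule inj_onI)
    fix x y assume xy: "x \<in> c0" "y \<in> c0" "T x = T y"
    define z where "z = (\<lambda>n. x n + (- 1) * y n)"
    have "z \<in> c0" unfolding z_def by (intro c0_add c0_scale xy)
    moreover have "T z = T x + (- 1) *\<^sub>R T y"
      unfolding z_def by (simp only: add[OF xy(1) c0_scale[OF xy(2)]] scale[OF xy(2)])
    ultimately have "\<bar>z n\<bar> \<le> 0" for n
      using lower[of z] c0_norm_upper[of z n] a xy(3) by (simp add: mult_le_0_iff)
    then show "x = y" by (auto simp: z_def fun_eq_iff)
  qed
  have Y: "subspace (T ` c0)" using add scale by (rule subspace_image_c0)
  have "\<exists>f. linear f \<and> (\<forall>x\<in>c0. f (T x) = a * x n) \<and> (\<forall>x. \<bar>f x\<bar> \<le> norm x)" for n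
  proof -
    define \<phi> where "\<phi> = (\<lambda>y. a * inv_into c0 T y n)"
    have \<phi>: "\<phi> (T x) = a * x n" if "x \<in> c0" for x
      using that inj by (simp add: \<phi>_def)
    obtain f where "linear f" "\<And>y. y \<in> T ` c0 \<Longrightarrow> f y = \<phi> y" "\<And>x. \<bar>f x\<bar> \<le> norm x"
    proof (rule Hahn_Banach_norm[OF Y, of \<phi>])
      show "\<phi> (y + z) = \<phi> y + \<phi> z" if yz: "y \<in> T ` c0" "z \<in> T ` c0" for y z
        using yz c0_add by (auto simp: \<phi> distrib_left simp flip: add)
      show "\<phi> (c *\<^sub>R y) = c * \<phi> y" if y: "y \<in> T ` c0" for c y
        using y c0_scale by (auto simp: \<phi> simp flip: scale)
      show "\<bar>\<phi> y\<bar> \<le> norm y" if y: "y \<in> T ` c0" for y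
      proof -
        obtain x where x: "x \<in> c0" "y = T x" using y by auto
        have "\<bar>\<phi> y\<bar> = a * \<bar>x n\<bar>" using x a by (simp add: \<phi> abs_mult)
        also have "\<dots> \<le> a * c0_norm x" using a c0_norm_upper[OF x(1)] by simp
        finally show ?thesis using lower[OF x(1)] x(2) by simp
      qed
    qed blast
    then show ?thesis using \<phi> by auto
  qed
  then obtain f where f: "\<And>n. linear (f n)" "\<And>n x. x \<in> c0 \<Longrightarrow> f n (T x) = a * x n"
    "\<And>n x. \<bar>f n x\<bar> \<le> norm x" by metis
  show thesis
  proof (rule that[of "\<lambda>n x. inverse a *\<^sub>R f n x"])
    show "linear (\<lambda>x. inverse a *\<^sub>R f n x)" for n
      by (rule linear_compose_scale_right[OF f(1)])
    show "inverse a *\<^sub>R f n (T x) = x n" if "x \<in> c0" for n x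
      using f(2)[OF that] a by simp
    show "\<bar>inverse a *\<^sub>R f n x\<bar> \<le> norm x / a" for n x
      using f(3)[of n x] a by (simp add: abs_mult field_simps)
  qed
qed

lemma c0_copy_clustering_functionals:
  fixes T :: "(nat \<Rightarrow> real) \<Rightarrow> 'a::real_normed_vector"
  assumes add: "\<And>x y. x \<in> c0 \<Longrightarrow> y \<in> c0 \<Longrightarrow> T (\<lambda>n. x n + y n) = T x + T y"
    and scale: "\<And>c x. x \<in> c0 \<Longrightarrow> T (\<lambda>n. c * x n) = c *\<^sub>R T x"
    and a: "0 < a" and lower: "\<And>x. x \<in> c0 \<Longrightarrow> a * c0_norm x \<le> norm (T x)"
  obtains g where "\<And>n. linear (g n)" "\<And>n x. x \<in> c0 \<Longrightarrow> g n (T x) = x n"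
    "\<And>n x. \<bar>g n x\<bar> \<le> 2 / a * norm x"
    "\<And>A e. finite A \<Longrightarrow> 0 < e \<Longrightarrow> \<exists>n. \<forall>x\<in>A. \<bar>g n x\<bar> < e"
proof -
  obtain h where h: "\<And>n. linear (h n)" "\<And>n x. x \<in> c0 \<Longrightarrow> h n (T x) = x n"
    "\<And>n x. \<bar>h n x\<bar> \<le> norm x / a"
    using c0_copy_coordinate_functionals[OF assms] by blast
  obtain L where L: "\<And>A e m. finite A \<Longrightarrow> 0 < e \<Longrightarrow> \<exists>n\<ge>m. \<forall>x\<in>A. \<bar>h n x - L x\<bar> < e"
    using pointwise_cluster_point[of h "\<lambda>x. norm x / a"] h(3) by blast
  have lin: "linear L" using linear_cluster_point[OF h(1) L] by blast
  have L0: "L (T x) = 0" if x: "x \<in> c0" for x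
  proof (rule ccontr)
    assume "L (T x) \<noteq> 0"
    then have e: "0 < \<bar>L (T x)\<bar> / 2" by simp
    have "x \<longlonglongrightarrow> 0" using x by (simp add: c0_def)
    then obtain m where m: "\<And>n. n \<ge> m \<Longrightarrow> \<bar>x n\<bar> < \<bar>L (T x)\<bar> / 2"
      using LIMSEQ_D[OF _ e, of x 0] by auto
    \<comment> \<open>The clause \<open>n \<ge> m\<close> matters here: far out,
      \<open>h n (T x) = x n\<close> is small, yet it is close to \<open>L (T x)\<close>.\<close>
    obtain n where "n \<ge> m" "\<bar>h n (T x) - L (T x)\<bar> < \<bar>L (T x)\<bar> / 2"
      using L[of "{T x}", OF _ e, of m] by auto
    with m[of n] h(2)[OF x, of n] show False by linarith
  qed
  have bound: "\<bar>L x\<bar> \<le> norm x / a" for x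
  proof (rule field_le_epsilon)
    fix e :: real assume "0 < e"
    then obtain n where "\<bar>h n x - L x\<bar> < e" using L[of "{x}" e 0] by auto
    then show "\<bar>L x\<bar> \<le> norm x / a + e" using h(3)[of n x] by linarith
  qed
  show thesis
  proof (rule that[of "\<lambda>n x. h n x - L x"])
    show "linear (\<lambda>x. h n x - L x)" for n
      using h(1) lin by (rule linear_compose_sub)
    show "h n (T x) - L (T x) = x n" if "x \<in> c0" for n x
      using h(2) L0 that by simp
    show "\<bar>h n x - L x\<bar> \<le> 2 / a * norm x" for n x
      using h(3)[of n x] bound[of x] abs_triangle_ineq4[of "h n x" "L x"] by simp
    show "\<exists>n. \<forall>x\<in>A. \<bar>h n x - L x\<bar> < e" if "finite A" "0 < e" for A e
      using L[OF that, of 0] by blast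
  qed
qed

section \<open>Renorming a space that contains c0\<close>

text \<open>The distance term ignores translations by the copy of c0, and adding a multiple of a
  unit vector changes only one \<open>g n\<close>. So the square condition reduces to an estimate of
  one coordinate.\<close>

lemma contains_c0_imp_SQ_renorming:
  assumes "contains_c0 TYPE('a::real_normed_vector)"
  shows "\<exists>N :: 'a \<Rightarrow> real. equivalent_norm N \<and> SQ_lt1_fin N"
proof -
  obtain T :: "(nat \<Rightarrow> real) \<Rightarrow> 'a" and a b where
    T: "\<forall>x\<in>c0. \<forall>y\<in>c0. T (\<lambda>n. x n + y n) = T x + T y"
      "\<forall>c. \<forall>x\<in>c0. T (\<lambda>n. c * x n) = c *\<^sub>R T x"
      "\<forall>x\<in>c0. a * c0_norm x \<le> norm (T x) \<and> norm (T x) \<le> b * c0_norm x"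
    and a: "0 < a" and b: "0 < b"
    using assms unfolding contains_c0_def by (elim exE conjE) (rule that)
  note add = T(1)[rule_format] and scale = T(2)[rule_format]
    and lower = T(3)[rule_format, THEN conjunct1] and upper = T(3)[rule_format, THEN conjunct2]
  obtain g where g: "\<And>n. linear (g n)" "\<And>n x. x \<in> c0 \<Longrightarrow> g n (T x) = x n"
    "\<And>n x. \<bar>g n x\<bar> \<le> 2 / a * norm x"
    "\<And>A e. finite A \<Longrightarrow> 0 < e \<Longrightarrow> \<exists>n. \<forall>x\<in>A. \<bar>g n x\<bar> < e"
    using c0_copy_clustering_functionals[OF add scale a lower] by blast
  note [simp] = linear_add[OF g(1)] linear_scale[OF g(1)] linear_diff[OF g(1)]
  have Y: "subspace (T ` c0)" using add scale by (rule subspace_image_c0)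
  note Y0 = subspace_0[OF Y]

  define d where "d = (\<lambda>x. INF y\<in>T ` c0. norm (x - y))"
  have d: "sublinear d" "\<And>x y. y \<in> T ` c0 \<Longrightarrow> d x \<le> norm (x - y)"
    using sublinear_inf_convolution[OF Y, of "\<lambda>_. 0"] by (simp_all add: d_def)
  have d_greatest: "r \<le> d x" if "\<And>y. y \<in> T ` c0 \<Longrightarrow> r \<le> norm (x - y)" for r x
    unfolding d_def by (rule cINF_greatest) (use Y0 that in auto)
  have d_nonneg: "0 \<le> d x" for x by (rule d_greatest) simp
  have d_minus: "d (- x) \<le> d x" for x
  proof (rule d_greatest)
    fix y assume "y \<in> T ` c0"
    then show "d (- x) \<le> norm (x - y)"
      using d(2)[of "- y" "- x"] subspace_neg[OF Y] norm_minus_commute[of x y] by simp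
  qed
  have d_Y: "d y = 0" if "y \<in> T ` c0" for y
    using d(2)[OF that, of y] d_nonneg[of y] by simp
  have d_shift: "d (x + y) \<le> d x" if "y \<in> T ` c0" for x y
    using sublinear_add[OF d(1), of x y] d_Y[OF that] by simp

  define G where "G = (\<lambda>x. SUP n. \<bar>g n x\<bar>)"
  have G_upper: "\<bar>g n x\<bar> \<le> G x" for n x
    unfolding G_def by (rule cSUP_upper) (use g(3) in \<open>auto intro!: bdd_aboveI2\<close>)
  have G_least: "G x \<le> r" if "\<And>n. \<bar>g n x\<bar> \<le> r" for x r
    unfolding G_def by (rule cSUP_least) (use that in auto)

  define N where "N = (\<lambda>x. max (d x) (G x))"
  have N_leI: "N x \<le> r" if "d x \<le> r" "\<And>n. \<bar>g n x\<bar> \<le> r" for x r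
    unfolding N_def using that G_least by simp
  have N_ge: "d x \<le> N x" "\<bar>g n x\<bar> \<le> N x" for x n
    unfolding N_def using G_upper[of n x] by auto
  have N_add: "N (x + y) \<le> N x + N y" for x y
  proof (rule N_leI)
    show "d (x + y) \<le> N x + N y"
      using sublinear_add[OF d(1), of x y] N_ge(1)[of x] N_ge(1)[of y] by simp
    show "\<bar>g n (x + y)\<bar> \<le> N x + N y" for n
      using N_ge(2)[of n x] N_ge(2)[of n y] by simp
  qed
  have N_pos_scale: "N (c *\<^sub>R x) \<le> c * N x" if "0 < c" for c x
  proof (rule N_leI)
    show "d (c *\<^sub>R x) \<le> c * N x"
      using sublinear_scale[OF d(1), of c x] that N_ge(1)[of x] by simp
    show "\<bar>g n (c *\<^sub>R x)\<bar> \<le> c * N x" for n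
      using that N_ge(2)[of n x] by (simp add: abs_mult)
  qed
  have N_sub: "sublinear N" by (rule sublinearI[OF N_add N_pos_scale])
  have N_minus_le: "N (- x) \<le> N x" for x
    using d_minus[of x] N_ge(1)[of x] N_ge(2)[of _ x] linear_neg[OF g(1)]
    by (intro N_leI) (auto intro: order_trans)
  then have N_minus: "N (- x) = N x" for x using N_minus_le[of "- x"] by (simp add: antisym)
  have N_scale: "N (c *\<^sub>R x) = \<bar>c\<bar> * N x" for c x
    using sublinear_scale[OF N_sub, of "\<bar>c\<bar>" x] N_minus[of "c *\<^sub>R x"]
    by (cases "0 \<le> c") (auto simp flip: scaleR_minus_left)
  have N_upper: "N x \<le> (1 + 2 / a) * norm x" for x
  proof (rule N_leI)
    have "0 \<le> 2 / a * norm x" using a by simp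
    then show "d x \<le> (1 + 2 / a) * norm x" using d(2)[OF Y0, of x] by (simp add: distrib_right)
    show "\<bar>g n x\<bar> \<le> (1 + 2 / a) * norm x" for n
      using g(3)[of n x] by (simp add: distrib_right add_increasing)
  qed
  \<comment> \<open>For \<open>y = T z\<close> in the copy, \<open>z n = g n x - g n (x - y)\<close>
    bounds \<open>c0_norm z\<close>, hence \<open>norm y\<close>, by \<open>N x\<close> and
    \<open>norm (x - y)\<close>. The triangle inequality then bounds \<open>norm x - b * N x\<close>
    by a multiple of \<open>norm (x - y)\<close>, and the infimum over \<open>y\<close> brings in
    \<open>d x\<close>.\<close>
  have N_lower: "norm x \<le> (1 + 2 * b / a + b) * N x" for x
  proof -
    have k: "0 < 1 + 2 * b / a" using a b by (simp add: add_pos_pos)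
    have "(norm x - b * N x) / (1 + 2 * b / a) \<le> d x"
    proof (rule d_greatest)
      fix y assume "y \<in> T ` c0"
      then obtain z where z: "z \<in> c0" "y = T z" by auto
      have "\<bar>z n\<bar> \<le> N x + 2 / a * norm (x - y)" for n
      proof -
        have "\<bar>z n\<bar> = \<bar>g n x - g n (x - y)\<bar>" using g(2)[OF z(1), of n] z(2) by simp
        then show ?thesis using N_ge(2)[of n x] g(3)[of n "x - y"] by linarith
      qed
      then have "c0_norm z \<le> N x + 2 / a * norm (x - y)" by (rule c0_norm_least)
      then have "b * c0_norm z \<le> b * (N x + 2 / a * norm (x - y))" using b by simp
      then have "norm y \<le> b * (N x + 2 / a * norm (x - y))" using upper[OF z(1)] z(2) by simp
      then have "norm x - b * N x \<le> (1 + 2 * b / a) * norm (x - y)"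
        using norm_triangle_sub[of x y] by (simp add: algebra_simps)
      then show "(norm x - b * N x) / (1 + 2 * b / a) \<le> norm (x - y)"
        using k by (simp only: pos_divide_le_eq mult.commute)
    qed
    also have "\<dots> \<le> N x" by (rule N_ge)
    finally show ?thesis using k by (simp only: pos_divide_le_eq) (simp add: algebra_simps)
  qed
  have "equivalent_norm N"
    unfolding equivalent_norm_def
  proof (intro conjI allI)
    show "N (x + y) \<le> N x + N y" for x y by (rule N_add)
    show "N (c *\<^sub>R x) = \<bar>c\<bar> * N x" for c x by (rule N_scale)
    show "N x = 0 \<longleftrightarrow> x = 0" for x
      using N_lower[of x] N_scale[of 0 x] by auto
    have k: "0 < 1 + 2 * b / a + b" using a b by (simp add: add_pos_pos)
    show "\<exists>a b. 0 < a \<and> 0 < b \<and> (\<forall>x. a * norm x \<le> N x \<and> N x \<le> b * norm x)"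
    proof (intro exI conjI allI)
      show "0 < inverse (1 + 2 * b / a + b)" using k by simp
      show "0 < 1 + 2 / a" using a by (simp add: add_pos_pos)
      show "inverse (1 + 2 * b / a + b) * norm x \<le> N x" for x
      proof -
        have "inverse (1 + 2 * b / a + b) * norm x
          \<le> inverse (1 + 2 * b / a + b) * ((1 + 2 * b / a + b) * N x)"
          using k N_lower[of x] by (intro mult_left_mono) auto
        also have "\<dots> = N x" using k by (simp only: mult.assoc[symmetric]) simp
        finally show ?thesis .
      qed
    qed (rule N_upper)
  qed
  moreover have "SQ_fin N s" if s: "0 < s" "s < 1" for s
    unfolding SQ_fin_def
  proof (intro allI impI, elim conjE)
    fix A assume A: "finite A" "A \<subseteq> {x. N x = 1}"
    \<comment> \<open>The threshold \<open>1 - s\<close> leaves room for a change by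
      \<open>s\<close> in coordinate \<open>n\<close>.\<close>
    obtain n where n: "\<And>x. x \<in> A \<Longrightarrow> \<bar>g n x\<bar> < 1 - s" using g(4)[OF A(1), of "1 - s"] s by auto
    define y where "y = T (\<lambda>m. of_bool (m = n))"
    have yY: "y \<in> T ` c0" unfolding y_def using c0_unit by blast
    have gy: "g m y = of_bool (m = n)" for m unfolding y_def by (rule g(2)[OF c0_unit])
    have "N y = 1"
    proof (rule antisym)
      show "N y \<le> 1" using d_Y[OF yY] by (intro N_leI) (auto simp: gy)
      show "1 \<le> N y" using N_ge(2)[of n y] by (simp add: gy)
    qed
    moreover have "N (x + t *\<^sub>R y) \<le> 1" if x: "x \<in> A" and t: "\<bar>t\<bar> = s" for x t
    proof (rule N_leI)
      have Nx: "N x = 1" using A(2) x by auto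
      show "d (x + t *\<^sub>R y) \<le> 1"
        using d_shift[OF subspace_scale[OF Y yY], of x t] N_ge(1)[of x] Nx by simp
      show "\<bar>g m (x + t *\<^sub>R y)\<bar> \<le> 1" for m
        using n[OF x] N_ge(2)[of m x] Nx t by (cases "m = n") (auto simp: gy)
    qed
    from this[of _ s] this[of _ "- s"]
    have "N (x + s *\<^sub>R y) \<le> 1 \<and> N (x - s *\<^sub>R y) \<le> 1" if "x \<in> A" for x
      using that s by simp
    ultimately show "\<exists>y. N y = 1 \<and> (\<forall>x\<in>A. N (x + s *\<^sub>R y) \<le> 1 \<and> N (x - s *\<^sub>R y) \<le> 1)" by blast
  qed
  ultimately show ?thesis by (auto simp: SQ_lt1_fin_def)
qed

section \<open>Constructing a copy of c0 from the square condition\<close>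

text \<open>The next vector depends on all sign sums formed so far, so the recursion carries the set
  of sums and recovers the vector as \<open>pick\<close> of that set.\<close>

primrec sign_sums :: "('a::real_vector set \<Rightarrow> 'a) \<Rightarrow> nat \<Rightarrow> 'a set" where
  "sign_sums pick 0 = {0}"
| "sign_sums pick (Suc n) =
     (\<lambda>x. x + pick (sign_sums pick n)) ` sign_sums pick n \<union>
     (\<lambda>x. x - pick (sign_sums pick n)) ` sign_sums pick n"

lemma finite_sign_sums: "finite (sign_sums pick n)"
  by (induction n) auto

text \<open>The condition passes from the sphere to the ball by convexity: with \<open>u\<close> the
  normalisation of \<open>x\<close>, the vector \<open>x + t *\<^sub>R y\<close> is the combination
  of \<open>u + t *\<^sub>R y\<close> and \<open>t *\<^sub>R y\<close> with weights
  \<open>N x\<close> and \<open>1 - N x\<close>.\<close>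

lemma SQ_fin_ball:
  assumes N: "equivalent_norm N" and SQ: "SQ_fin N s" and s: "0 \<le> s" "s \<le> 1"
    and A: "finite A" "\<And>x. x \<in> A \<Longrightarrow> N x \<le> 1"
  shows "\<exists>y. N y = 1 \<and> (\<forall>x\<in>A. N (x + s *\<^sub>R y) \<le> 1 \<and> N (x - s *\<^sub>R y) \<le> 1)"
proof -
  have add: "N (x + y) \<le> N x + N y" and scale: "N (c *\<^sub>R x) = \<bar>c\<bar> * N x"
    and zero: "N x = 0 \<longleftrightarrow> x = 0" for x y c
    using N by (auto simp: equivalent_norm_def)
  have nonneg: "0 \<le> N x" for x
    using add[of x "- x"] scale[of "- 1" x] zero[of 0] by simp
  define B where "B = (\<lambda>x. inverse (N x) *\<^sub>R x) ` (A - {0})"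
  have "finite B" "B \<subseteq> {x. N x = 1}"
    using A(1) nonneg by (auto simp: B_def scale zero)
  then have "\<exists>y. N y = 1 \<and> (\<forall>x\<in>B. N (x + s *\<^sub>R y) \<le> 1 \<and> N (x - s *\<^sub>R y) \<le> 1)"
    using SQ[unfolded SQ_fin_def, THEN spec, THEN mp, of B] by simp
  then obtain y where y: "N y = 1" "\<And>x. x \<in> B \<Longrightarrow> N (x + s *\<^sub>R y) \<le> 1 \<and> N (x - s *\<^sub>R y) \<le> 1"
    by auto
  have "N (x + t *\<^sub>R y) \<le> 1" if x: "x \<in> A" and t: "t = s \<or> t = - s" for x t
  proof (cases "x = 0")
    case True
    then show ?thesis using t s y(1) by (auto simp: scale)
  next
    case False
    define u where "u = inverse (N x) *\<^sub>R x"
    have xu: "x = N x *\<^sub>R u" using False by (simp add: u_def zero)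
    have u: "N (u + t *\<^sub>R y) \<le> 1"
      using y(2)[of u] x False t by (auto simp: B_def u_def)
    have "x + t *\<^sub>R y = N x *\<^sub>R (u + t *\<^sub>R y) + ((1 - N x) * t) *\<^sub>R y"
      by (subst xu) (simp add: algebra_simps)
    then have "N (x + t *\<^sub>R y) \<le> N x * N (u + t *\<^sub>R y) + (1 - N x) * s"
      using add[of "N x *\<^sub>R (u + t *\<^sub>R y)" "((1 - N x) * t) *\<^sub>R y"] nonneg[of x] A(2)[OF x] y(1) s t
      by (auto simp: scale abs_mult)
    also have "\<dots> \<le> N x * 1 + (1 - N x) * 1"
      using u nonneg[of x] A(2)[OF x] s by (intro add_mono mult_left_mono) auto
    finally show ?thesis by simp
  qed
  from this[of _ s] this[of _ "- s"] y(1) show ?thesis by (intro exI[of _ y]) auto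
qed

text \<open>
  Any ratio s strictly between 1/2 and 1 would do: if all sign sums of the vectors chosen so far have
  norm at most 1/s, then so do the sign sums including the next vector.
\<close>
lemma SQ_bounded_sums:
  fixes N :: "'a::real_normed_vector \<Rightarrow> real"
  assumes N: "equivalent_norm N" and SQ: "SQ_fin N (2/3)"
  obtains y :: "nat \<Rightarrow> 'a" where "\<And>n. N (y n) = 1"
    "\<And>n c M. (\<And>i. i < n \<Longrightarrow> \<bar>c i\<bar> \<le> M) \<Longrightarrow> 0 \<le> M \<Longrightarrow> N (\<Sum>i<n. c i *\<^sub>R y i) \<le> 3/2 * M"
proof -
  have add: "N (x + y) \<le> N x + N y" and scale: "N (c *\<^sub>R x) = \<bar>c\<bar> * N x"
    and zero: "N x = 0 \<longleftrightarrow> x = 0" for x y c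
    using N by (auto simp: equivalent_norm_def)
  have "\<exists>y. N y = 1 \<and> (\<forall>x\<in>A. N (x + y) \<le> 3/2 \<and> N (x - y) \<le> 3/2)"
    if A: "finite A" "\<And>x. x \<in> A \<Longrightarrow> N x \<le> 3/2" for A
  proof -
    \<comment> \<open>Scaling by \<open>2/3\<close> moves \<open>A\<close> into the unit ball; the
      bound found there for \<open>(2/3) *\<^sub>R (x + y)\<close> and
      \<open>(2/3) *\<^sub>R (x - y)\<close> is scaled back to \<open>3/2\<close>.\<close>
    have "finite ((\<lambda>x. (2/3) *\<^sub>R x) ` A)" "\<And>x. x \<in> (\<lambda>x. (2/3) *\<^sub>R x) ` A \<Longrightarrow> N x \<le> 1"
      using A by (fastforce simp: scale)+
    then obtain y where y: "N y = 1" "\<And>x. x \<in> A \<Longrightarrow>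
        N ((2/3) *\<^sub>R x + (2/3) *\<^sub>R y) \<le> 1 \<and> N ((2/3) *\<^sub>R x - (2/3) *\<^sub>R y) \<le> 1"
      using SQ_fin_ball[OF N SQ, of "(\<lambda>x. (2/3) *\<^sub>R x) ` A"] by auto
    then have "N (x + y) \<le> 3/2 \<and> N (x - y) \<le> 3/2" if "x \<in> A" for x
      using y(2)[OF that] scale[of "2/3" "x + y"] scale[of "2/3" "x - y"]
      by (simp add: scaleR_add_right scaleR_diff_right)
    with y(1) show ?thesis by blast
  qed
  then obtain pick where pick: "\<And>A. finite A \<Longrightarrow> (\<And>x. x \<in> A \<Longrightarrow> N x \<le> 3/2) \<Longrightarrow>
      N (pick A) = 1 \<and> (\<forall>x\<in>A. N (x + pick A) \<le> 3/2 \<and> N (x - pick A) \<le> 3/2)"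
    by metis
  define S where "S = sign_sums pick"
  define y where "y = (\<lambda>n. pick (S n))"
  have S_Suc: "S (Suc n) = (\<lambda>x. x + y n) ` S n \<union> (\<lambda>x. x - y n) ` S n" for n
    by (simp add: S_def y_def)
  have S_bound: "N x \<le> 3/2" if "x \<in> S n" for n x
    using that
  proof (induction n arbitrary: x)
    case 0
    then show ?case using zero[of 0] by (simp add: S_def)
  next
    case (Suc n)
    have "finite (S n)" by (simp add: S_def finite_sign_sums)
    from pick[OF this Suc.IH] Suc.prems show ?case by (auto simp: S_Suc y_def)
  qed
  have y1: "N (y n) = 1" for n
    unfolding y_def using pick[of "S n"] S_bound by (simp add: S_def finite_sign_sums)
  \<comment> \<open>The translation \<open>x\<close> makes the induction go through: it absorbs
    \<open>y n\<close> with either sign while the remaining coefficients are treated.\<close>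
  have hull: "N (x + (\<Sum>i<n. c i *\<^sub>R y i)) \<le> 3/2"
    if "\<And>z. z \<in> S n \<Longrightarrow> N (x + z) \<le> 3/2" "\<And>i. i < n \<Longrightarrow> \<bar>c i\<bar> \<le> 1" for x c n
    using that
  proof (induction n arbitrary: x)
    case 0
    then show ?case by (simp add: S_def)
  next
    case (Suc n)
    define z where "z = (\<Sum>i<n. c i *\<^sub>R y i)"
    have c: "\<bar>c n\<bar> \<le> 1" using Suc.prems(2) by simp
    have "N (x + y n + w) \<le> 3/2" "N (x - y n + w) \<le> 3/2" if "w \<in> S n" for w
      using Suc.prems(1)[of "w + y n"] Suc.prems(1)[of "w - y n"] that
      by (auto simp: S_Suc algebra_simps)
    then have 1: "N (x + y n + z) \<le> 3/2" "N (x - y n + z) \<le> 3/2"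
      unfolding z_def using Suc.prems(2) by (intro Suc.IH; simp)+
    \<comment> \<open>The coefficient \<open>c n\<close> in \<open>[-1, 1]\<close> is the average of
      the signs \<open>1\<close> and \<open>-1\<close> with weights \<open>(1 + c n) / 2\<close> and
      \<open>(1 - c n) / 2\<close>.\<close>
    have "x + (\<Sum>i<Suc n. c i *\<^sub>R y i)
        = ((1 + c n) / 2) *\<^sub>R (x + y n + z) + ((1 - c n) / 2) *\<^sub>R (x - y n + z)"
    proof -
      have "((1 + c n) / 2) *\<^sub>R (x + y n + z) + ((1 - c n) / 2) *\<^sub>R (x - y n + z)
        = ((1 + c n) / 2 + (1 - c n) / 2) *\<^sub>R (x + z) + ((1 + c n) / 2 - (1 - c n) / 2) *\<^sub>R y n"
        by (simp only: scaleR_add_left scaleR_diff_left scaleR_add_right scaleR_diff_right) simp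
      also have "\<dots> = x + z + c n *\<^sub>R y n" by (simp add: field_simps)
      finally show ?thesis by (simp add: z_def add.assoc)
    qed
    also have "N \<dots> \<le> (1 + c n) / 2 * N (x + y n + z) + (1 - c n) / 2 * N (x - y n + z)"
      using add[of "((1 + c n) / 2) *\<^sub>R (x + y n + z)" "((1 - c n) / 2) *\<^sub>R (x - y n + z)"] c
      by (simp add: scale)
    also have "\<dots> \<le> (1 + c n) / 2 * (3/2) + (1 - c n) / 2 * (3/2)"
      using c 1 by (intro add_mono mult_left_mono) auto
    finally show ?case by (simp add: field_simps)
  qed
  show thesis
  proof (rule that[of y])
    show "N (y n) = 1" for n by (rule y1)
    fix n :: nat and c :: "nat \<Rightarrow> real" and M :: real
    assume c: "\<And>i. i < n \<Longrightarrow> \<bar>c i\<bar> \<le> M" and "0 \<le> M"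
    show "N (\<Sum>i<n. c i *\<^sub>R y i) \<le> 3/2 * M"
    proof (cases "M = 0")
      case True
      then have "(\<Sum>i<n. c i *\<^sub>R y i) = 0" using c by (intro sum.neutral) auto
      then show ?thesis using True zero[of 0] by simp
    next
      case False
      with \<open>0 \<le> M\<close> have M: "0 < M" by simp
      have "N (0 + (\<Sum>i<n. (c i / M) *\<^sub>R y i)) \<le> 3/2"
        by (rule hull) (use S_bound c M in \<open>auto simp: field_simps\<close>)
      moreover have "(\<Sum>i<n. c i *\<^sub>R y i) = M *\<^sub>R (\<Sum>i<n. (c i / M) *\<^sub>R y i)"
        using M by (simp add: scaleR_sum_right)
      ultimately show ?thesis using M by (simp add: scale mult.commute)
    qed
  qed
qed

lemma SQ_renorming_imp_contains_c0:
  fixes N :: "'a::banach \<Rightarrow> real"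
  assumes N: "equivalent_norm N" and SQ: "SQ_fin N (2/3)"
  shows "contains_c0 TYPE('a)"
proof -
  have add: "N (x + y) \<le> N x + N y" and scale: "N (c *\<^sub>R x) = \<bar>c\<bar> * N x" for x y c
    using N by (auto simp: equivalent_norm_def)
  obtain a b where a: "0 < a" and b: "0 < b"
    and N_lower: "\<And>x. a * norm x \<le> N x" and N_upper: "\<And>x. N x \<le> b * norm x"
    using N unfolding equivalent_norm_def by blast
  obtain y :: "nat \<Rightarrow> 'a" where y: "\<And>n. N (y n) = 1"
    "\<And>n c M. (\<And>i. i < n \<Longrightarrow> \<bar>c i\<bar> \<le> M) \<Longrightarrow> 0 \<le> M \<Longrightarrow> N (\<Sum>i<n. c i *\<^sub>R y i) \<le> 3/2 * M"
    using SQ_bounded_sums[OF N SQ] by blast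
  have summable: "summable (\<lambda>i. x i *\<^sub>R y i)" if x: "x \<in> c0" for x
    unfolding summable_Cauchy
  proof (intro allI impI)
    fix e :: real assume e: "0 < e"
    \<comment> \<open>With this choice a block of the series has \<open>N\<close> at most
      \<open>3/2 * M = 3/4 * a * e\<close>, which is below \<open>a * e\<close>.\<close>
    define M where "M = a * e / 2"
    have M: "0 < M" using a e by (simp add: M_def)
    have "x \<longlonglongrightarrow> 0" using x by (simp add: c0_def)
    then obtain k where k: "\<And>n. n \<ge> k \<Longrightarrow> \<bar>x n\<bar> < M"
      using LIMSEQ_D[OF _ M, of x 0] by auto
    show "\<exists>k. \<forall>m\<ge>k. \<forall>n. norm (\<Sum>i = m..<n. x i *\<^sub>R y i) < e"
    proof (intro exI[of _ k] allI impI)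
      fix m n assume m: "k \<le> m"
      have "(\<Sum>i = m..<n. x i *\<^sub>R y i) = (\<Sum>i<n. (if i < m then 0 else x i) *\<^sub>R y i)"
        by (rule sum.mono_neutral_cong_left) auto
      also have "N \<dots> \<le> 3/2 * M"
        using k m M by (intro y(2)) (auto intro: less_imp_le)
      finally have "a * norm (\<Sum>i = m..<n. x i *\<^sub>R y i) \<le> 3/2 * M"
        using N_lower order_trans by blast
      also have "\<dots> < a * e" using a e by (simp add: M_def)
      finally show "norm (\<Sum>i = m..<n. x i *\<^sub>R y i) < e" using a by simp
    qed
  qed
  define T where "T = (\<lambda>x. \<Sum>i. x i *\<^sub>R y i)"
  have lim: "(\<lambda>n. norm (\<Sum>i<n. x i *\<^sub>R y i)) \<longlonglongrightarrow> norm (T x)" if "x \<in> c0" for x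
    unfolding T_def using summable_LIMSEQ[OF summable[OF that]] by (rule tendsto_norm)
  have c0_norm_nonneg: "0 \<le> c0_norm x" if "x \<in> c0" for x
    using c0_norm_upper[OF that, of 0] by simp
  have upper: "norm (T x) \<le> 3 / (2 * a) * c0_norm x" if x: "x \<in> c0" for x
  proof (rule LIMSEQ_le_const2[OF lim[OF x]], intro exI allI impI)
    fix n :: nat
    have "a * norm (\<Sum>i<n. x i *\<^sub>R y i) \<le> 3/2 * c0_norm x"
      using y(2)[of n x "c0_norm x"] c0_norm_upper[OF x] c0_norm_nonneg[OF x] N_lower order_trans
      by blast
    then show "norm (\<Sum>i<n. x i *\<^sub>R y i) \<le> 3 / (2 * a) * c0_norm x"
      using a by (simp add: field_simps)
  qed
  have lower: "1 / (2 * b) * c0_norm x \<le> norm (T x)" if x: "x \<in> c0" for x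
  proof -
    define M where "M = c0_norm x"
    have coord: "(2 * \<bar>x j\<bar> - 3/2 * M) / b \<le> norm (T x)" for j
    proof (rule LIMSEQ_le_const[OF lim[OF x]], intro exI allI impI)
      fix n assume n: "Suc j \<le> n"
      define v where "v = (\<Sum>i<n. x i *\<^sub>R y i)"
      \<comment> \<open>All signs but the \<open>j\<close>-th are reversed, so only
        \<open>2 * x j\<close> survives in \<open>v + w\<close>; \<open>n\<close> exceeds
        \<open>j\<close> to keep this term in the range.\<close>
      define w where "w = (\<Sum>i<n. (if i = j then x i else - x i) *\<^sub>R y i)"
      have "v + w = (\<Sum>i<n. if i = j then (2 * x j) *\<^sub>R y j else 0)"
        unfolding v_def w_def sum.distrib[symmetric]
        by (intro sum.cong) (auto simp flip: scaleR_add_left)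
      also have "\<dots> = (2 * x j) *\<^sub>R y j" using n by simp
      finally have "2 * \<bar>x j\<bar> = N (v + w)" by (simp add: scale y(1) abs_mult)
      also have "\<dots> \<le> N v + N w" by (rule add)
      also have "\<dots> \<le> b * norm v + 3/2 * M"
        unfolding w_def M_def using c0_norm_upper[OF x] c0_norm_nonneg[OF x]
        by (intro add_mono N_upper y(2)) auto
      finally show "(2 * \<bar>x j\<bar> - 3/2 * M) / b \<le> norm (\<Sum>i<n. x i *\<^sub>R y i)"
        using b by (simp add: v_def field_simps)
    qed
    have "\<bar>x j\<bar> \<le> (b * norm (T x) + 3/2 * M) / 2" for j
      using coord[of j] b by (simp add: field_simps)
    \<comment> \<open>Taking the supremum over \<open>j\<close> leaves \<open>M\<close> on both
      sides; solving for it yields the constant \<open>1 / (2 * b)\<close>.\<close>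
    then have "M \<le> (b * norm (T x) + 3/2 * M) / 2" unfolding M_def by (rule c0_norm_least)
    then show ?thesis using b by (simp add: M_def field_simps)
  qed
  show ?thesis
    unfolding contains_c0_def
  proof (intro exI[of _ T] conjI ballI allI)
    show "T (\<lambda>n. x n + z n) = T x + T z" if "x \<in> c0" "z \<in> c0" for x z
      unfolding T_def scaleR_add_left using suminf_add[OF summable summable] that by simp
    show "T (\<lambda>n. c * x n) = c *\<^sub>R T x" if "x \<in> c0" for c x
      unfolding T_def using suminf_scaleR_right[OF summable[OF that], of c] by simp
    show "\<exists>a b. 0 < a \<and> 0 < b \<and> (\<forall>x\<in>c0. a * c0_norm x \<le> norm (T x) \<and> norm (T x) \<le> b * c0_norm x)"
      using lower upper a b by (intro exI[of _ "1 / (2 * b)"] exI[of _ "3 / (2 * a)"]) auto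
  qed
qed

theorem theorem6p8:
  shows "contains_c0 TYPE('a::banach) \<longleftrightarrow>
         (\<exists>N :: 'a \<Rightarrow> real. equivalent_norm N \<and> SQ_lt1_fin N)"
proof
  assume "contains_c0 TYPE('a)"
  then show "\<exists>N :: 'a \<Rightarrow> real. equivalent_norm N \<and> SQ_lt1_fin N"
    by (rule contains_c0_imp_SQ_renorming)
next
  assume "\<exists>N :: 'a \<Rightarrow> real. equivalent_norm N \<and> SQ_lt1_fin N"
  then obtain N :: "'a \<Rightarrow> real" where "equivalent_norm N" "SQ_fin N (2/3)"
    by (auto simp: SQ_lt1_fin_def)
  then show "contains_c0 TYPE('a)" by (rule SQ_renorming_imp_contains_c0)
qed

end
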